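(* Let $L:\mathcal{D}\to\mathcal{E}$ and $R:\mathcal{E}\to\mathcal{D}$ form a Galois correspondence $(L,R)$ between concrete categories $\mathcal{D}$ and $\mathcal{E}$ over a category $\mathcal{B}$. A concrete category $\mathcal{X}$ over $\mathcal{B}$ is concretely equivalent to $\mathsf{Fix}(RL)$ if, and only if, there exist essentially surjective concrete functors $F:\mathcal{D}\to\mathcal{X}$ and $G:\mathcal{E}\to\mathcal{X}$ such that $$\mathcal{E}(LX,Y)=\mathcal{X}(FX,GY)\quad\text{for all }X\in\mathcal{D}_0,\ Y\in\mathcal{E}_0.$$
   Context: Concrete categories. A concrete category $\mathcal{E}$ over $\mathcal{B}$ (a faithful functor $|\text{-}|:\mathcal{E}\to\mathcal{B}$, with $\mathcal{E}(X,Y)$ identified with its image) is given by a class $\mathcal{E}_0$ of objects, a function $|\text{-}|:\mathcal{E}_0\to\mathcal{B}_0$, and subsets $\mathcal{E}(X,Y)\subseteq\mathcal{B}(|X|,|Y|)$ with $1_{|X|}\in\mathcal{E}(X,X)$ and $\mathcal{E}(Y,Z)\circ\mathcal{E}(X,Y)\subseteq\mathcal{E}(X,Z)$. A concrete functor $F:\mathcal{D}\to\mathcal{E}$ is a function $F:\mathcal{D}_0\to\mathcal{E}_0$ with $|FX|=|X|$ and $\mathcal{D}(X,Y)\subseteq\mathcal{E}(FX,FY)$. Hom-sets such as $\mathcal{E}(LX,Y)$ and $\mathcal{X}(FX,GY)$ are compared as subsets of $\mathcal{B}(|X|,|Y|)$. Order and $\cong$. In a concrete category $\mathcal{E}$,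 $X\le Y$ means $|X|=|Y|$ and $1_{|X|}\in\mathcal{E}(X,Y)$; $X\cong Y$ means $X\le Y$ and $Y\le X$ (stronger than isomorphism in the ordinary sense). Concrete functors are ordered pointwise, and $F\cong G$ means $FX\cong GX$ for all $X$. Concrete functors $L:\mathcal{D}\to\mathcal{E}$ and $R:\mathcal{E}\to\mathcal{D}$ form a Galois correspondence $(L,R)$ if $1_{\mathcal{D}}\le RL$ and $LR\le 1_{\mathcal{E}}$; equivalently $\mathcal{E}(LX,Y)=\mathcal{D}(X,RY)$ for all $X\in\mathcal{D}_0$, $Y\in\mathcal{E}_0$. $\mathsf{Fix}(RL)$ is the full subcategory of $\mathcal{D}$ whose objects are those $X\in\mathcal{D}_0$ with $RLX\cong X$. Concrete categories $\mathcal{X},\mathcal{Y}$ are concretely equivalent if there are concrete functors $P:\mathcal{X}\to\mathcal{Y}$, $P':\mathcal{Y}\to\mathcal{X}$ with $1_{\mathcal{X}}\cong P'P$ and $PP'\cong 1_{\mathcal{Y}}$. A concrete functor $F:\mathcal{D}\to\mathcal{X}$ is essentially surjective if for every $Y\in\mathcal{X}_0$ there is $X\in\mathcal{D}_0$ with $Y\cong FX$. *)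

theory Defs
  imports Main
begin

record ('o, 'm) cat_data =
  Obj :: "'o set"
  Arr :: "'m set"
  Dom :: "'m \<Rightarrow> 'o"
  Cod :: "'m \<Rightarrow> 'o"
  Ident :: "'o \<Rightarrow> 'm"
  Comp :: "'m \<Rightarrow> 'm \<Rightarrow> 'm"

definition Hom :: "('o, 'm) cat_data \<Rightarrow> 'o \<Rightarrow> 'o \<Rightarrow> 'm set" where
  "Hom B A C = {f \<in> Arr B. Dom B f = A \<and> Cod B f = C}"

text \<open>Composition is written in the order of application of functions:
  \<open>Comp B g f\<close> is "g after f".  It is unconstrained on non-composable pairs.\<close>

locale category =
  fixes B :: "('o, 'm) cat_data"
  assumes Dom_Obj: "f \<in> Arr B \<Longrightarrow> Dom B f \<in> Obj B"
    and Cod_Obj: "f \<in> Arr B \<Longrightarrow> Cod B f \<in> Obj B"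
    and Ident_Hom: "a \<in> Obj B \<Longrightarrow> Ident B a \<in> Hom B a a"
    and Comp_Hom: "f \<in> Hom B a b \<Longrightarrow> g \<in> Hom B b c \<Longrightarrow> Comp B g f \<in> Hom B a c"
    and Comp_Ident_right: "f \<in> Hom B a b \<Longrightarrow> Comp B f (Ident B a) = f"
    and Comp_Ident_left: "f \<in> Hom B a b \<Longrightarrow> Comp B (Ident B b) f = f"
    and Comp_assoc: "f \<in> Hom B a b \<Longrightarrow> g \<in> Hom B b c \<Longrightarrow> h \<in> Hom B c d \<Longrightarrow>
      Comp B h (Comp B g f) = Comp B (Comp B h g) f"

text \<open>A concrete category over \<open>B\<close> is given by its class of objects, the action \<open>forget\<close> of the
  forgetful functor on objects, and its hom-sets as sets of arrows of \<open>B\<close>.\<close>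

record ('x, 'o, 'm) conc_data =
  cobj :: "'x set"
  forget :: "'x \<Rightarrow> 'o"
  chom :: "'x \<Rightarrow> 'x \<Rightarrow> 'm set"

locale concrete_category = category B
  for B :: "('o, 'm) cat_data" +
  fixes E :: "('x, 'o, 'm) conc_data"
  assumes forget_Obj: "X \<in> cobj E \<Longrightarrow> forget E X \<in> Obj B"
    and chom_subset: "X \<in> cobj E \<Longrightarrow> Y \<in> cobj E \<Longrightarrow>
      chom E X Y \<subseteq> Hom B (forget E X) (forget E Y)"
    and Ident_chom: "X \<in> cobj E \<Longrightarrow> Ident B (forget E X) \<in> chom E X X"
    and Comp_chom: "X \<in> cobj E \<Longrightarrow> Y \<in> cobj E \<Longrightarrow> Z \<in> cobj E \<Longrightarrow>
      f \<in> chom E X Y \<Longrightarrow> g \<in> chom E Y Z \<Longrightarrow> Comp B g f \<in> chom E X Z"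

definition concrete_functor ::
  "('x, 'o, 'm) conc_data \<Rightarrow> ('y, 'o, 'm) conc_data \<Rightarrow> ('x \<Rightarrow> 'y) \<Rightarrow> bool" where
  "concrete_functor D E F \<longleftrightarrow>
     (\<forall>X\<in>cobj D. F X \<in> cobj E \<and> forget E (F X) = forget D X) \<and>
     (\<forall>X\<in>cobj D. \<forall>Y\<in>cobj D. chom D X Y \<subseteq> chom E (F X) (F Y))"

definition conc_le :: "('o, 'm) cat_data \<Rightarrow> ('x, 'o, 'm) conc_data \<Rightarrow> 'x \<Rightarrow> 'x \<Rightarrow> bool" where
  "conc_le B E X Y \<longleftrightarrow> forget E X = forget E Y \<and> Ident B (forget E X) \<in> chom E X Y"

definition conc_cong :: "('o, 'm) cat_data \<Rightarrow> ('x, 'o, 'm) conc_data \<Rightarrow> 'x \<Rightarrow> 'x \<Rightarrow> bool" where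
  "conc_cong B E X Y \<longleftrightarrow> conc_le B E X Y \<and> conc_le B E Y X"

text \<open>The pointwise relations between concrete functors from \<open>D\<close> to \<open>E\<close>.\<close>

definition cfun_le :: "('o, 'm) cat_data \<Rightarrow> ('x, 'o, 'm) conc_data \<Rightarrow> ('y, 'o, 'm) conc_data \<Rightarrow>
    ('x \<Rightarrow> 'y) \<Rightarrow> ('x \<Rightarrow> 'y) \<Rightarrow> bool" where
  "cfun_le B D E F G \<longleftrightarrow> (\<forall>X\<in>cobj D. conc_le B E (F X) (G X))"

definition cfun_cong :: "('o, 'm) cat_data \<Rightarrow> ('x, 'o, 'm) conc_data \<Rightarrow> ('y, 'o, 'm) conc_data \<Rightarrow>
    ('x \<Rightarrow> 'y) \<Rightarrow> ('x \<Rightarrow> 'y) \<Rightarrow> bool" where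
  "cfun_cong B D E F G \<longleftrightarrow> (\<forall>X\<in>cobj D. conc_cong B E (F X) (G X))"

definition galois_correspondence :: "('o, 'm) cat_data \<Rightarrow> ('x, 'o, 'm) conc_data \<Rightarrow>
    ('y, 'o, 'm) conc_data \<Rightarrow> ('x \<Rightarrow> 'y) \<Rightarrow> ('y \<Rightarrow> 'x) \<Rightarrow> bool" where
  "galois_correspondence B D E L R \<longleftrightarrow>
     concrete_functor D E L \<and> concrete_functor E D R \<and>
     cfun_le B D D id (R \<circ> L) \<and> cfun_le B E E (L \<circ> R) id"

definition full_subcategory ::
  "('x, 'o, 'm) conc_data \<Rightarrow> 'x set \<Rightarrow> ('x, 'o, 'm) conc_data" where
  "full_subcategory D S = \<lparr>cobj = S, forget = forget D, chom = chom D\<rparr>"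

definition Fix :: "('o, 'm) cat_data \<Rightarrow> ('x, 'o, 'm) conc_data \<Rightarrow> ('x \<Rightarrow> 'x) \<Rightarrow>
    ('x, 'o, 'm) conc_data" where
  "Fix B D T = full_subcategory D {X \<in> cobj D. conc_cong B D (T X) X}"

definition concretely_equivalent :: "('o, 'm) cat_data \<Rightarrow> ('x, 'o, 'm) conc_data \<Rightarrow>
    ('y, 'o, 'm) conc_data \<Rightarrow> bool" where
  "concretely_equivalent B \<X> \<Y> \<longleftrightarrow>
     (\<exists>P P'. concrete_functor \<X> \<Y> P \<and> concrete_functor \<Y> \<X> P' \<and>
        cfun_cong B \<X> \<X> id (P' \<circ> P) \<and> cfun_cong B \<Y> \<Y> (P \<circ> P') id)"

definition essentially_surjective :: "('o, 'm) cat_data \<Rightarrow> ('x, 'o, 'm) conc_data \<Rightarrow>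
    ('y, 'o, 'm) conc_data \<Rightarrow> ('x \<Rightarrow> 'y) \<Rightarrow> bool" where
  "essentially_surjective B D \<X> F \<longleftrightarrow> (\<forall>Y\<in>cobj \<X>. \<exists>X\<in>cobj D. conc_cong B \<X> Y (F X))"

lemma (in concrete_category) concrete_category_full_subcategory:
  assumes "S \<subseteq> cobj E"
  shows "concrete_category B (full_subcategory E S)"
proof unfold_locales
  fix X Y Z f g
  assume "X \<in> cobj (full_subcategory E S)" "Y \<in> cobj (full_subcategory E S)"
    "Z \<in> cobj (full_subcategory E S)"
    "f \<in> chom (full_subcategory E S) X Y" "g \<in> chom (full_subcategory E S) Y Z"
  then show "Comp B g f \<in> chom (full_subcategory E S) X Z"
    using assms Comp_chom[of X Y Z f g] by (auto simp: full_subcategory_def)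
qed (use assms forget_Obj chom_subset Ident_chom in
      \<open>auto simp: full_subcategory_def subset_iff\<close>)

lemma (in concrete_category) concrete_category_Fix: "concrete_category B (Fix B E T)"
  unfolding Fix_def by (rule concrete_category_full_subcategory) auto

end

theory Submission
  imports Defs
begin

text \<open>
  A Galois correspondence \<open>(L, R)\<close> is a hom-set identity \<open>E(LA, Y) = D(A, RY)\<close>, and every
  object \<open>RY\<close>, in particular every \<open>RLA\<close>, is a fixed point of \<open>RL\<close>.  Replacing \<open>A\<close> by \<open>RLA\<close>
  does not change the left-hand side, because \<open>LRLA \<cong> LA\<close>, so \<open>E(LA, Y) = D(RLA, RY)\<close>.
  Moreover a fixed point \<open>A \<cong> RLA\<close> is hit, up to \<open>\<cong>\<close>, both by \<open>RL\<close> and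
  by \<open>R\<close>.  Hence \<open>RL\<close> and \<open>R\<close> are the required functors when \<open>X\<close> is \<open>Fix(RL)\<close> itself, and
  composing with a concrete equivalence, which is full and essentially surjective, gives them for
  any concretely equivalent \<open>X\<close> (\<open>equivalent_FixRL_imp_functors\<close>).

  Conversely, let \<open>E(LA, Y) = X(FA, GY)\<close> with \<open>F\<close>, \<open>G\<close> essentially surjective.  The key fact
  is that then \<open>F \<cong> GL\<close> and \<open>G \<cong> FR\<close> (\<open>F_cong_GL\<close>, \<open>G_cong_FR\<close>).  One inequality of each is
  the identity of \<open>LA\<close>, or of \<open>RY\<close>, read through the hom-set identities; the other compares \<open>FA\<close>
  with some \<open>GY \<cong> FA\<close>, and is where essential surjectivity enters.  Now
  \<open>X(GY, GY') = X(FRY, GY') = E(LRY, Y') = D(RY, RY')\<close>.  So choosing for each \<open>Z\<close> an object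
  \<open>Y\<close> with \<open>Z \<cong> GY\<close> and sending \<open>Z\<close> to \<open>RY\<close> is a concrete functor to \<open>Fix(RL)\<close>, and \<open>F\<close>
  restricted to \<open>Fix(RL)\<close> is its inverse up to \<open>\<cong>\<close> (\<open>equivalent_FixRL\<close>).
\<close>

section \<open>The order of a concrete category and concrete functors\<close>

context concrete_category
begin

text \<open>The identities witnessing \<open>X' \<le> X\<close> and \<open>Y \<le> Y'\<close> are composed with an arrow of
  \<open>E(X, Y)\<close> without changing it.\<close>

lemma chom_mono:
  assumes "X \<in> cobj E" "X' \<in> cobj E" "Y \<in> cobj E" "Y' \<in> cobj E"
    and "conc_le B E X' X" "conc_le B E Y Y'"
  shows "chom E X Y \<subseteq> chom E X' Y'"
proof
  fix f assume f: "f \<in> chom E X Y"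
  then have f_Hom: "f \<in> Hom B (forget E X) (forget E Y)"
    using chom_subset assms by blast
  have "Comp B f (Ident B (forget E X)) \<in> chom E X' Y"
    using Comp_chom[of X' X Y "Ident B (forget E X)" f] assms f by (auto simp: conc_le_def)
  then have "f \<in> chom E X' Y"
    using f_Hom by (simp add: Comp_Ident_right)
  then have "Comp B (Ident B (forget E Y)) f \<in> chom E X' Y'"
    using Comp_chom[of X' Y Y' f "Ident B (forget E Y)"] assms by (auto simp: conc_le_def)
  then show "f \<in> chom E X' Y'"
    using f_Hom by (simp add: Comp_Ident_left)
qed

lemma conc_le_refl: "X \<in> cobj E \<Longrightarrow> conc_le B E X X"
  by (simp add: conc_le_def Ident_chom)

lemma conc_le_trans:
  assumes "conc_le B E X Y" "conc_le B E Y Z" "X \<in> cobj E" "Y \<in> cobj E" "Z \<in> cobj E"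
  shows "conc_le B E X Z"
  using assms chom_mono[of X X Y Z] conc_le_refl[of X] by (auto simp: conc_le_def)

lemma conc_cong_trans:
  assumes "conc_cong B E X Y" "conc_cong B E Y Z" "X \<in> cobj E" "Y \<in> cobj E" "Z \<in> cobj E"
  shows "conc_cong B E X Z"
  using assms conc_le_trans unfolding conc_cong_def by blast

lemma chom_cong:
  assumes "conc_cong B E X X'" "conc_cong B E Y Y'"
    and "X \<in> cobj E" "X' \<in> cobj E" "Y \<in> cobj E" "Y' \<in> cobj E"
  shows "chom E X Y = chom E X' Y'"
  using assms by (intro equalityI chom_mono) (simp_all add: conc_cong_def)

end

lemma conc_cong_sym: "conc_cong B E X Y \<Longrightarrow> conc_cong B E Y X"
  by (auto simp: conc_cong_def)

lemma conc_cong_forget: "conc_cong B E X Y \<Longrightarrow> forget E X = forget E Y"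
  unfolding conc_cong_def conc_le_def by blast

lemma concrete_functor_obj:
  "concrete_functor D E F \<Longrightarrow> X \<in> cobj D \<Longrightarrow> F X \<in> cobj E"
  "concrete_functor D E F \<Longrightarrow> X \<in> cobj D \<Longrightarrow> forget E (F X) = forget D X"
  by (auto simp: concrete_functor_def)

lemma concrete_functor_chom:
  "concrete_functor D E F \<Longrightarrow> X \<in> cobj D \<Longrightarrow> Y \<in> cobj D \<Longrightarrow> chom D X Y \<subseteq> chom E (F X) (F Y)"
  by (auto simp: concrete_functor_def)

lemma concrete_functor_comp:
  "concrete_functor C D F \<Longrightarrow> concrete_functor D E G \<Longrightarrow> concrete_functor C E (G \<circ> F)"
  unfolding concrete_functor_def by (simp add: subset_eq)

lemma concrete_functor_le:
  assumes "concrete_functor D E F" "X \<in> cobj D" "Y \<in> cobj D" "conc_le B D X Y"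
  shows "conc_le B E (F X) (F Y)"
  using assms unfolding concrete_functor_def conc_le_def by (metis subsetD)

lemma concrete_functor_cong:
  assumes "concrete_functor D E F" "X \<in> cobj D" "Y \<in> cobj D" "conc_cong B D X Y"
  shows "conc_cong B E (F X) (F Y)"
  using assms concrete_functor_le unfolding conc_cong_def by metis

text \<open>A functor with a left inverse up to \<open>\<cong>\<close> is full: apply the left inverse to an arrow between
  images.\<close>

lemma concrete_functor_full:
  assumes "concrete_category B D" "concrete_functor D E F" "concrete_functor E D F'"
    and "cfun_cong B D D (F' \<circ> F) id" "X \<in> cobj D" "Y \<in> cobj D"
  shows "chom E (F X) (F Y) = chom D X Y"
proof
  have obj: "F X \<in> cobj E" "F Y \<in> cobj E" "F' (F X) \<in> cobj D" "F' (F Y) \<in> cobj D"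
    using assms by (simp_all add: concrete_functor_obj)
  have "chom E (F X) (F Y) \<subseteq> chom D (F' (F X)) (F' (F Y))"
    using concrete_functor_chom[OF assms(3)] obj by blast
  also have "\<dots> = chom D X Y"
    using concrete_category.chom_cong[OF assms(1)] assms(4-6) obj
    by (simp add: cfun_cong_def)
  finally show "chom E (F X) (F Y) \<subseteq> chom D X Y" .
qed (rule concrete_functor_chom[OF assms(2,5,6)])

section \<open>Galois correspondences and their fixed points\<close>

locale concrete_galois =
  D: concrete_category B D + E: concrete_category B E
  for B :: "('o, 'm) cat_data"
    and D :: "('d, 'o, 'm) conc_data" and E :: "('e, 'o, 'm) conc_data" +
  fixes L :: "'d \<Rightarrow> 'e" and R :: "'e \<Rightarrow> 'd"
  assumes galois: "galois_correspondence B D E L R"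
begin

lemma L_functor: "concrete_functor D E L"
  and R_functor: "concrete_functor E D R"
  using galois by (simp_all add: galois_correspondence_def)

lemma unit: "X \<in> cobj D \<Longrightarrow> conc_le B D X (R (L X))"
  and counit: "Y \<in> cobj E \<Longrightarrow> conc_le B E (L (R Y)) Y"
  using galois by (simp_all add: galois_correspondence_def cfun_le_def)

lemmas L_obj = concrete_functor_obj[OF L_functor]
lemmas R_obj = concrete_functor_obj[OF R_functor]

lemma galois_chom:
  assumes "X \<in> cobj D" "Y \<in> cobj E"
  shows "chom E (L X) Y = chom D X (R Y)"
proof
  have "chom E (L X) Y \<subseteq> chom D (R (L X)) (R Y)"
    using assms by (simp add: concrete_functor_chom[OF R_functor] L_obj)
  also have "\<dots> \<subseteq> chom D X (R Y)"
    using assms by (simp add: D.chom_mono D.conc_le_refl unit L_obj R_obj)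
  finally show "chom E (L X) Y \<subseteq> chom D X (R Y)" .
  have "chom D X (R Y) \<subseteq> chom E (L X) (L (R Y))"
    using assms by (simp add: concrete_functor_chom[OF L_functor] R_obj)
  also have "\<dots> \<subseteq> chom E (L X) Y"
    using assms by (simp add: E.chom_mono E.conc_le_refl counit L_obj R_obj)
  finally show "chom D X (R Y) \<subseteq> chom E (L X) Y" .
qed

lemma R_fixed: "Y \<in> cobj E \<Longrightarrow> conc_cong B D (R (L (R Y))) (R Y)"
  unfolding conc_cong_def
  by (simp add: unit counit concrete_functor_le[OF R_functor] L_obj R_obj)

lemma L_fixed: "X \<in> cobj D \<Longrightarrow> conc_cong B E (L (R (L X))) (L X)"
  unfolding conc_cong_def
  by (simp add: unit counit concrete_functor_le[OF L_functor] L_obj R_obj)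

text \<open>Since \<open>LRLA \<cong> LA\<close>, the object \<open>A\<close> may be replaced by \<open>RLA\<close> before transposing.  In this
  form both arguments on the right are fixed points.\<close>

lemma galois_chom_RL:
  assumes "X \<in> cobj D" "Y \<in> cobj E"
  shows "chom E (L X) Y = chom D (R (L X)) (R Y)"
proof -
  have "chom E (L X) Y = chom E (L (R (L X))) Y"
    using assms E.chom_cong[OF L_fixed, of X Y Y] E.conc_le_refl[of Y]
    by (simp add: conc_cong_def L_obj R_obj)
  also have "\<dots> = chom D (R (L X)) (R Y)"
    using assms by (simp add: galois_chom L_obj R_obj)
  finally show ?thesis .
qed

abbreviation FixRL :: "('d, 'o, 'm) conc_data" where
  "FixRL \<equiv> Fix B D (R \<circ> L)"

lemma FixRL_simps:
  "X \<in> cobj FixRL \<longleftrightarrow> X \<in> cobj D \<and> conc_cong B D (R (L X)) X"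
  "chom FixRL = chom D"
  "forget FixRL = forget D"
  by (auto simp: Fix_def full_subcategory_def)

lemma conc_cong_FixRL: "conc_cong B FixRL = conc_cong B D"
  by (intro ext) (simp add: conc_cong_def conc_le_def FixRL_simps)

lemma R_functor_Fix: "concrete_functor E FixRL R"
  using R_functor R_fixed by (auto simp: concrete_functor_def FixRL_simps)

text \<open>On \<open>Fix(RL)\<close> itself the required pair of functors is \<open>RL\<close> and \<open>R\<close>; the equivalence
  carries it over to \<open>X\<close>.\<close>

lemma equivalent_FixRL_imp_functors:
  fixes X :: "('x, 'o, 'm) conc_data"
  assumes X: "concrete_category B X" and equiv: "concretely_equivalent B X FixRL"
  shows "\<exists>F G. concrete_functor D X F \<and> essentially_surjective B D X F \<and>
    concrete_functor E X G \<and> essentially_surjective B E X G \<and>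
    (\<forall>A\<in>cobj D. \<forall>Y\<in>cobj E. chom E (L A) Y = chom X (F A) (G Y))"
proof -
  interpret X: concrete_category B X by (rule X)
  obtain P P' where P: "concrete_functor X FixRL P" and P': "concrete_functor FixRL X P'"
    and P'P: "cfun_cong B X X id (P' \<circ> P)" and PP': "cfun_cong B FixRL FixRL (P \<circ> P') id"
    using equiv unfolding concretely_equivalent_def by blast
  have G: "concrete_functor E X (P' \<circ> R)"
    by (rule concrete_functor_comp[OF R_functor_Fix P'])
  have F: "concrete_functor D X (P' \<circ> R \<circ> L)"
    by (rule concrete_functor_comp[OF L_functor G])
  (* The same object P Z serves for both functors: P' (R (L (P Z))) is a value of P' o R o L at
     P Z, and of P' o R at L (P Z). *)
  have F_dense: "conc_cong B X Z ((P' \<circ> R \<circ> L) (P Z))" and PZ: "P Z \<in> cobj D"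
    if Z: "Z \<in> cobj X" for Z
  proof -
    have PZ_Fix: "P Z \<in> cobj FixRL"
      using P Z by (rule concrete_functor_obj)
    then show PZ: "P Z \<in> cobj D"
      by (simp add: FixRL_simps)
    have RLPZ_Fix: "R (L (P Z)) \<in> cobj FixRL"
      using concrete_functor_obj(1)[OF R_functor_Fix] PZ L_obj by blast
    have "conc_cong B X (P' (P Z)) (P' (R (L (P Z))))"
      using PZ_Fix RLPZ_Fix
      by (intro concrete_functor_cong[OF P'])
        (auto simp: conc_cong_FixRL FixRL_simps intro: conc_cong_sym)
    moreover have "conc_cong B X Z (P' (P Z))"
      using P'P Z by (simp add: cfun_cong_def)
    ultimately show "conc_cong B X Z ((P' \<circ> R \<circ> L) (P Z))"
      using X.conc_cong_trans[of Z "P' (P Z)"] Z concrete_functor_obj(1)[OF P'] PZ_Fix RLPZ_Fix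
      by simp
  qed
  have "essentially_surjective B D X (P' \<circ> R \<circ> L)"
    unfolding essentially_surjective_def using F_dense PZ by blast
  moreover have "essentially_surjective B E X (P' \<circ> R)"
    unfolding essentially_surjective_def using F_dense PZ L_obj(1) by (metis comp_apply)
  moreover have "chom E (L A) Y = chom X ((P' \<circ> R \<circ> L) A) ((P' \<circ> R) Y)"
    if "A \<in> cobj D" "Y \<in> cobj E" for A Y
  proof -
    have "chom E (L A) Y = chom FixRL (R (L A)) (R Y)"
      using that by (simp add: galois_chom_RL FixRL_simps)
    also have "\<dots> = chom X (P' (R (L A))) (P' (R Y))"
      using concrete_functor_full[OF D.concrete_category_Fix P' P PP']
        concrete_functor_obj(1)[OF R_functor_Fix] that L_obj by simp
    finally show ?thesis by simp
  qed
  ultimately show ?thesis using F G by blast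
qed

end

section \<open>Hom-set identities through a third category\<close>

locale galois_factorization = concrete_galois B D E L R + X: concrete_category B X
  for B :: "('o, 'm) cat_data"
    and D :: "('d, 'o, 'm) conc_data" and E :: "('e, 'o, 'm) conc_data"
    and L :: "'d \<Rightarrow> 'e" and R :: "'e \<Rightarrow> 'd" and X :: "('x, 'o, 'm) conc_data" +
  fixes F :: "'d \<Rightarrow> 'x" and G :: "'e \<Rightarrow> 'x"
  assumes F_functor: "concrete_functor D X F"
    and F_surj: "essentially_surjective B D X F"
    and G_functor: "concrete_functor E X G"
    and G_surj: "essentially_surjective B E X G"
    and chom_FG: "A \<in> cobj D \<Longrightarrow> Y \<in> cobj E \<Longrightarrow> chom E (L A) Y = chom X (F A) (G Y)"
begin

lemmas F_obj = concrete_functor_obj[OF F_functor]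
lemmas G_obj = concrete_functor_obj[OF G_functor]

text \<open>The hom-set identities applied to identity arrows.\<close>

lemma le_adjoint:
  assumes "A \<in> cobj D" "Y \<in> cobj E"
  shows "conc_le B X (F A) (G Y) \<longleftrightarrow> conc_le B E (L A) Y"
    and "conc_le B X (F A) (G Y) \<longleftrightarrow> conc_le B D A (R Y)"
  using assms chom_FG[of A Y] galois_chom[of A Y]
  by (simp_all add: conc_le_def F_obj G_obj L_obj R_obj)

text \<open>If \<open>GY \<cong> FA\<close>, then \<open>FA \<le> GY\<close> says that \<open>LA \<le> Y\<close>, and therefore
  \<open>GLA \<le> GY \<cong> FA\<close>.\<close>

lemma F_cong_GL:
  assumes A: "A \<in> cobj D"
  shows "conc_cong B X (F A) (G (L A))"
proof -
  obtain Y where Y: "Y \<in> cobj E" "conc_cong B X (F A) (G Y)"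
    using G_surj F_obj A unfolding essentially_surjective_def by blast
  then have "conc_le B E (L A) Y"
    using le_adjoint(1)[OF A] by (simp add: conc_cong_def)
  then have "conc_le B X (G (L A)) (G Y)"
    using concrete_functor_le[OF G_functor] A L_obj Y by blast
  then have "conc_le B X (G (L A)) (F A)"
    using X.conc_le_trans[of "G (L A)" "G Y" "F A"] A Y F_obj G_obj L_obj
    by (simp add: conc_cong_def)
  moreover have "conc_le B X (F A) (G (L A))"
    using le_adjoint(1) A L_obj E.conc_le_refl by blast
  ultimately show ?thesis
    by (simp add: conc_cong_def)
qed

text \<open>Dually, if \<open>FA \<cong> GY\<close>, then \<open>A \<le> RY\<close>, and therefore \<open>GY \<cong> FA \<le> FRY\<close>.\<close>

lemma G_cong_FR:
  assumes Y: "Y \<in> cobj E"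
  shows "conc_cong B X (G Y) (F (R Y))"
proof -
  obtain A where A: "A \<in> cobj D" "conc_cong B X (G Y) (F A)"
    using F_surj G_obj Y unfolding essentially_surjective_def by blast
  then have "conc_le B D A (R Y)"
    using le_adjoint(2)[OF _ Y] by (simp add: conc_cong_def)
  then have "conc_le B X (F A) (F (R Y))"
    using concrete_functor_le[OF F_functor] A R_obj Y by blast
  then have "conc_le B X (G Y) (F (R Y))"
    using X.conc_le_trans[of "G Y" "F A" "F (R Y)"] A Y F_obj G_obj R_obj
    by (simp add: conc_cong_def)
  moreover have "conc_le B X (F (R Y)) (G Y)"
    using le_adjoint(2) Y R_obj D.conc_le_refl by blast
  ultimately show ?thesis
    by (simp add: conc_cong_def)
qed

lemma chom_G_eq_chom_R:
  assumes "Y \<in> cobj E" "Y' \<in> cobj E"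
  shows "chom X (G Y) (G Y') = chom D (R Y) (R Y')"
proof -
  have "chom X (G Y) (G Y') = chom X (F (R Y)) (G Y')"
    using assms X.chom_cong[OF G_cong_FR, of Y "G Y'" "G Y'"] X.conc_le_refl[of "G Y'"]
    by (simp add: conc_cong_def F_obj G_obj R_obj)
  also have "\<dots> = chom D (R Y) (R Y')"
    using assms chom_FG galois_chom R_obj by simp
  finally show ?thesis .
qed

text \<open>The functor into \<open>Fix(RL)\<close> is a choice of \<open>RY\<close> with \<open>Z \<cong> GY\<close>; two choices of \<open>Y\<close> give
  \<open>\<cong>\<close>-related values, since \<open>X(GY, GY') = D(RY, RY')\<close>.\<close>

lemma equivalent_FixRL: "concretely_equivalent B X FixRL"
proof -
  obtain c where c_cong: "\<And>Z. Z \<in> cobj X \<Longrightarrow> conc_cong B X Z (G (c Z))"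
    and c_obj: "\<And>Z. Z \<in> cobj X \<Longrightarrow> c Z \<in> cobj E"
    using G_surj unfolding essentially_surjective_def by metis
  have chom_c: "chom X Z Z' = chom D (R (c Z)) (R (c Z'))"
    if "Z \<in> cobj X" "Z' \<in> cobj X" for Z Z'
    using X.chom_cong[OF c_cong c_cong] chom_G_eq_chom_R[of "c Z" "c Z'"] that c_obj G_obj
    by simp
  have forget_c: "forget E (c Z) = forget X Z" if "Z \<in> cobj X" for Z
    using conc_cong_forget[OF c_cong[OF that]] G_obj(2)[OF c_obj[OF that]] by simp
  have Rc_obj: "R (c Z) \<in> cobj FixRL" if "Z \<in> cobj X" for Z
    using concrete_functor_obj(1)[OF R_functor_Fix] c_obj that by blast
  have P: "concrete_functor X FixRL (R \<circ> c)"
    using Rc_obj chom_c forget_c c_obj R_obj(2)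
    by (simp add: concrete_functor_def FixRL_simps)
  have P': "concrete_functor FixRL X F"
    using F_functor by (auto simp: concrete_functor_def FixRL_simps)
  have "conc_cong B X Z (F (R (c Z)))" if "Z \<in> cobj X" for Z
    using X.conc_cong_trans[OF c_cong G_cong_FR] that c_obj F_obj G_obj R_obj by blast
  then have "cfun_cong B X X id (F \<circ> (R \<circ> c))"
    by (simp add: cfun_cong_def)
  moreover have "conc_cong B FixRL (R (c (F A))) A" if A: "A \<in> cobj FixRL" for A
  proof -
    have AD: "A \<in> cobj D" and fixed: "conc_cong B D (R (L A)) A"
      using A by (simp_all add: FixRL_simps)
    have obj: "c (F A) \<in> cobj E" "L A \<in> cobj E" "R (c (F A)) \<in> cobj D" "R (L A) \<in> cobj D"
      using AD by (simp_all add: c_obj F_obj L_obj R_obj)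
    have "conc_cong B X (G (c (F A))) (G (L A))"
      using X.conc_cong_trans[OF conc_cong_sym[OF c_cong] F_cong_GL] AD obj F_obj G_obj
      by blast
    then have "conc_cong B D (R (c (F A))) (R (L A))"
      using obj unfolding conc_cong_def conc_le_def by (metis chom_G_eq_chom_R G_obj(2) R_obj(2))
    then have "conc_cong B D (R (c (F A))) A"
      using D.conc_cong_trans fixed obj AD by blast
    then show ?thesis
      by (simp add: conc_cong_FixRL)
  qed
  then have "cfun_cong B FixRL FixRL (R \<circ> c \<circ> F) id"
    by (simp add: cfun_cong_def)
  ultimately show ?thesis
    using P P' unfolding concretely_equivalent_def by blast
qed

end

theorem theorem7p5:
  fixes B :: "('o, 'm) cat_data"
    and \<D> :: "('d, 'o, 'm) conc_data"
    and \<E> :: "('e, 'o, 'm) conc_data"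
    and \<X> :: "('x, 'o, 'm) conc_data"
    and L :: "'d \<Rightarrow> 'e" and R :: "'e \<Rightarrow> 'd"
  assumes "category B"
    and "concrete_category B \<D>"
    and "concrete_category B \<E>"
    and "galois_correspondence B \<D> \<E> L R"
    and "concrete_category B \<X>"
  shows "concretely_equivalent B \<X> (Fix B \<D> (R \<circ> L)) \<longleftrightarrow>
    (\<exists>(F :: 'd \<Rightarrow> 'x) (G :: 'e \<Rightarrow> 'x).
       concrete_functor \<D> \<X> F \<and> essentially_surjective B \<D> \<X> F \<and>
       concrete_functor \<E> \<X> G \<and> essentially_surjective B \<E> \<X> G \<and>
       (\<forall>X\<in>cobj \<D>. \<forall>Y\<in>cobj \<E>. chom \<E> (L X) Y = chom \<X> (F X) (G Y)))"
proof -
  have galois: "concrete_galois B \<D> \<E> L R"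
    using assms by (simp add: concrete_galois_def concrete_galois_axioms_def)
  show ?thesis
  proof
    assume "concretely_equivalent B \<X> (Fix B \<D> (R \<circ> L))"
    then show "\<exists>F G. concrete_functor \<D> \<X> F \<and> essentially_surjective B \<D> \<X> F \<and>
       concrete_functor \<E> \<X> G \<and> essentially_surjective B \<E> \<X> G \<and>
       (\<forall>X\<in>cobj \<D>. \<forall>Y\<in>cobj \<E>. chom \<E> (L X) Y = chom \<X> (F X) (G Y))"
      by (rule concrete_galois.equivalent_FixRL_imp_functors[OF galois assms(5)])
  next
    assume "\<exists>F G. concrete_functor \<D> \<X> F \<and> essentially_surjective B \<D> \<X> F \<and>
       concrete_functor \<E> \<X> G \<and> essentially_surjective B \<E> \<X> G \<and>
       (\<forall>X\<in>cobj \<D>. \<forall>Y\<in>cobj \<E>. chom \<E> (L X) Y = chom \<X> (F X) (G Y))"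
    then obtain F G where "galois_factorization B \<D> \<E> L R \<X> F G"
      using galois assms(5)
      unfolding galois_factorization_def galois_factorization_axioms_def by blast
    then show "concretely_equivalent B \<X> (Fix B \<D> (R \<circ> L))"
      by (rule galois_factorization.equivalent_FixRL)
  qed
qed

end
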